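(* Let $q$ be a prime power, $n=q^2+q+1$, and let $D\subseteq\mathbb{Z}_n$ be a difference set such that $0\notin D$ and $|D|=q+1$. Then $h(C_n(J(D)))=n$.
   Context: A harmonious $k$-coloring of a finite simple graph $G$ is a proper vertex coloring with $k$ colors such that every (unordered) pair of colors appears on at most one edge. The harmonious chromatic number $h(G)$ is the minimum $k$ such that $G$ has a harmonious $k$-coloring. For $n\ge 3$ and $J\subseteq\{1,\dots,\lfloor n/2\rfloor\}\subseteq\mathbb{Z}_n$, the circulant graph $C_n(J)$ has vertex set $\mathbb{Z}_n$ and edge set $\{ij:|\{i-j,j-i\}\cap J|=1\}$. A subset $D$ of $\mathbb{Z}_n$ is a difference set if for each nonzero $g\in\mathbb{Z}_n$ there is a unique ordered pair of different elements $d_i,d_j\in D$ such that $g=d_i-d_j$. For a difference set $D\subseteq\mathbb{Z}_n$ with $0\notin D$ (elements represented by integers in $\{1,\dots,n-1\}$), $J(D)=\{i: i\in D,\ i\le n/2\}\cup\{n-i: i\in D,\ i>n/2\}$. *)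

theory Defs
  imports "Graph_Theory.Pair_Digraph" "HOL-Number_Theory.Prime_Powers"
begin

text \<open>
  Finite simple graphs are the \<^locale>\<open>pair_graph\<close>s of Graph_Theory: every undirected edge is a
  pair of opposite arcs. The undirected edges are recovered as two-element sets, so that
  ``at most one edge'' does not count the two orientations separately.
\<close>

definition uedges :: "'a pair_pre_digraph \<Rightarrow> 'a set set" where
  "uedges G = (\<lambda>(u, v). {u, v}) ` parcs G"

definition proper_coloring :: "'a pair_pre_digraph \<Rightarrow> nat \<Rightarrow> ('a \<Rightarrow> nat) \<Rightarrow> bool" where
  "proper_coloring G k c \<longleftrightarrow>
     c ` pverts G \<subseteq> {..<k} \<and> (\<forall>(u, v) \<in> parcs G. c u \<noteq> c v)"

text \<open>For an edge \<open>e = {u, v}\<close>, \<open>c ` e\<close> is the unordered pair of colors on \<open>e\<close>.\<close>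

definition harmonious_coloring :: "'a pair_pre_digraph \<Rightarrow> nat \<Rightarrow> ('a \<Rightarrow> nat) \<Rightarrow> bool" where
  "harmonious_coloring G k c \<longleftrightarrow>
     proper_coloring G k c \<and> (\<forall>e \<in> uedges G. \<forall>f \<in> uedges G. c ` e = c ` f \<longrightarrow> e = f)"

definition harmonious_chromatic_number :: "'a pair_pre_digraph \<Rightarrow> nat" where
  "harmonious_chromatic_number G = (LEAST k. \<exists>c. harmonious_coloring G k c)"

text \<open>The minimum is attained on every finite simple graph, so \<open>LEAST\<close> is meaningful there.\<close>

lemma (in pair_graph) harmonious_coloring_exists: "\<exists>c. harmonious_coloring G (card (pverts G)) c"
proof -
  obtain c where c: "bij_betw c (pverts G) {0..<card (pverts G)}"
    using ex_bij_betw_finite_nat[OF pair_finite_verts] by blast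
  then have inj: "inj_on c (pverts G)" by (simp add: bij_betw_def)
  have sub: "e \<subseteq> pverts G" if "e \<in> uedges G" for e
    using that by (auto simp: uedges_def dest: in_arcsD1 in_arcsD2)
  have "c u \<noteq> c v" if "(u, v) \<in> parcs G" for u v
    using that inj pair_no_loops[OF that] by (auto dest: inj_onD in_arcsD1 in_arcsD2)
  moreover have "e = f" if "e \<in> uedges G" "f \<in> uedges G" "c ` e = c ` f" for e f
    using inj_on_image_eq_iff[OF inj] sub that by blast
  ultimately show ?thesis
    using c unfolding harmonious_coloring_def proper_coloring_def
    by (intro exI[of _ c]) (auto simp: bij_betw_def)
qed

text \<open>
  \<open>\<int>\<^sub>n\<close> is represented by the residues \<open>{0..<int n}\<close>, with differences reduced modulo \<open>n\<close>.
\<close>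

definition circulant_graph :: "nat \<Rightarrow> int set \<Rightarrow> int pair_pre_digraph" where
  "circulant_graph n J =
     \<lparr>pverts = {0..<int n},
      parcs = {(i, j). i \<in> {0..<int n} \<and> j \<in> {0..<int n} \<and>
                card ({(i - j) mod int n, (j - i) mod int n} \<inter> J) = 1}\<rparr>"

lemma pair_graph_circulant_graph:
  assumes "n \<ge> 3" and "J \<subseteq> {1..int n div 2}"
  shows "pair_graph (circulant_graph n J)"
proof -
  have fin: "finite (parcs (circulant_graph n J))"
    by (rule finite_subset[of _ "{0..<int n} \<times> {0..<int n}"]) (auto simp: circulant_graph_def)
  have "0 \<notin> J" using assms(2) by auto
  then show ?thesis
    using fin
    by unfold_locales
      (auto simp: circulant_graph_def symmetric_def sym_def insert_commute)
qed

definition is_difference_set :: "nat \<Rightarrow> int set \<Rightarrow> bool" where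
  "is_difference_set n D \<longleftrightarrow>
     D \<subseteq> {0..<int n} \<and>
     (\<forall>g \<in> {0..<int n}. g \<noteq> 0 \<longrightarrow>
        (\<exists>!p. p \<in> D \<times> D \<and> fst p \<noteq> snd p \<and> g = (fst p - snd p) mod int n))"

definition connection_set :: "nat \<Rightarrow> int set \<Rightarrow> int set" where
  "connection_set n D =
     {i. i \<in> D \<and> real_of_int i \<le> real n / 2} \<union> {int n - i | i. i \<in> D \<and> real_of_int i > real n / 2}"

lemma connection_set_subset:
  assumes "D \<subseteq> {0..<int n}" and "0 \<notin> D"
  shows "connection_set n D \<subseteq> {1..int n div 2}"
proof
  fix x assume "x \<in> connection_set n D"
  then consider "x \<in> D" "real_of_int x \<le> real n / 2"
    | i where "i \<in> D" "real_of_int i > real n / 2" "x = int n - i"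
    by (auto simp: connection_set_def)
  then show "x \<in> {1..int n div 2}"
  proof cases
    case 1
    then have "2 * x \<le> int n" by linarith
    moreover have "x \<noteq> 0" "x \<ge> 0" using 1 assms by auto
    ultimately show ?thesis by auto
  next
    case 2
    then have "2 * i > int n" by linarith
    moreover have "i < int n" using 2 assms by auto
    ultimately show ?thesis using 2 by auto
  qed
qed

end

theory Submission
  imports Defs
begin

text \<open>
  In a harmonious coloring, two distinct vertices \<open>u\<close>, \<open>v\<close> with a common neighbor \<open>w\<close> get
  different colors, since otherwise the edges \<open>uw\<close> and \<open>wv\<close> would carry the same pair of colors.
  So a graph in which any two distinct vertices have a common neighbor needs as many colors as it
  has vertices, and that many always suffice (one color per vertex).

  The circulant graph of a difference set \<open>D\<close> with \<open>0 \<notin> D\<close> is such a graph. Folding \<open>D\<close> into the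
  interval up to \<open>n/2\<close> only forgets signs, so vertices whose difference lies in \<open>D\<close> are
  adjacent (\<open>circulant_arcI\<close>). For distinct \<open>u\<close>, \<open>v\<close> the difference property gives
  \<open>v - u = a - b\<close> with \<open>a, b \<in> D\<close>, and then \<open>w = v - a = u - b\<close> is a common neighbor, all modulo \<open>n\<close>.
\<close>

lemma (in pair_graph) harmonious_chromatic_number_eq_card:
  assumes common: "\<And>u v. \<lbrakk>u \<in> pverts G; v \<in> pverts G; u \<noteq> v\<rbrakk> \<Longrightarrow>
                     \<exists>w. (u, w) \<in> parcs G \<and> (v, w) \<in> parcs G"
  shows "harmonious_chromatic_number G = card (pverts G)"
  unfolding harmonious_chromatic_number_def
proof (rule Least_equality)
  show "\<exists>c. harmonious_coloring G (card (pverts G)) c"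
    by (rule harmonious_coloring_exists)
next
  fix k assume "\<exists>c. harmonious_coloring G k c"
  then obtain c where c: "harmonious_coloring G k c" ..
  have "inj_on c (pverts G)"
  proof (rule inj_onI, rule ccontr)
    fix u v assume uv: "u \<in> pverts G" "v \<in> pverts G" "c u = c v" "u \<noteq> v"
    then obtain w where w: "(u, w) \<in> parcs G" "(v, w) \<in> parcs G"
      using common by blast
    then have "{u, w} \<in> uedges G" "{v, w} \<in> uedges G"
      by (force simp: uedges_def)+
    moreover have "c ` {u, w} = c ` {v, w}" using uv(3) by simp
    ultimately have "{u, w} = {v, w}"
      using c unfolding harmonious_coloring_def by blast
    with uv(4) show False by (auto simp: doubleton_eq_iff)
  qed
  moreover have "c ` pverts G \<subseteq> {..<k}"
    using c by (simp add: harmonious_coloring_def proper_coloring_def)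
  ultimately have "card (pverts G) \<le> card {..<k}"
    by (intro card_inj_on_le) auto
  then show "card (pverts G) \<le> k" by simp
qed

text \<open>
  Of \<open>d\<close> and \<open>n - d\<close>, only the one in the lower half can lie in the connection set, and it does
  when \<open>d \<in> D\<close>. For \<open>d = n - d\<close> the two coincide, so the intersection is a singleton in that
  case too.
\<close>

lemma circulant_arcI:
  assumes D: "D \<subseteq> {0..<int n}" "0 \<notin> D"
    and ij: "i \<in> {0..<int n}" "j \<in> {0..<int n}"
    and dD: "(i - j) mod int n \<in> D"
  shows "(i, j) \<in> parcs (circulant_graph n (connection_set n D))"
proof -
  define d where "d = (i - j) mod int n"
  let ?J = "connection_set n D"
  have d: "d \<in> D" "0 < d" "d < int n"
  proof -
    show "d \<in> D" using dD by (simp add: d_def)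
    then have "d \<noteq> 0" "d \<in> {0..<int n}" using D by auto
    then show "0 < d" "d < int n" by simp_all
  qed
  have neg: "(j - i) mod int n = int n - d"
    using d(2) zmod_zminus1_eq_if[of "i - j" "int n"] unfolding d_def by simp
  have J: "x \<le> int n div 2" if "x \<in> ?J" for x
    using connection_set_subset[OF D] that by auto
  have "\<exists>m. {d, int n - d} \<inter> ?J = {m}"
  proof (cases "2 * d \<le> int n")
    case True
    then have "real_of_int d \<le> real n / 2" by linarith
    then have "d \<in> ?J" using d by (auto simp: connection_set_def)
    moreover have "int n - d = d" if "int n - d \<in> ?J"
      using J[OF that] True by linarith
    ultimately have "{d, int n - d} \<inter> ?J = {d}" by auto
    then show ?thesis ..
  next
    case False
    then have "real_of_int d > real n / 2" by linarith
    then have "int n - d \<in> ?J" using d by (auto simp: connection_set_def)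
    moreover have "d \<notin> ?J" using J[of d] False by linarith
    ultimately have "{d, int n - d} \<inter> ?J = {int n - d}" by auto
    then show ?thesis ..
  qed
  then have "card ({(i - j) mod int n, (j - i) mod int n} \<inter> ?J) = 1"
    unfolding neg d_def[symmetric] by (rule exE) simp
  with ij show ?thesis by (simp add: circulant_graph_def)
qed

lemma difference_set_common_neighbor:
  assumes D: "is_difference_set n D" "0 \<notin> D"
    and uv: "u \<in> {0..<int n}" "v \<in> {0..<int n}" "u \<noteq> v"
  shows "\<exists>w. (u, w) \<in> parcs (circulant_graph n (connection_set n D)) \<and>
             (v, w) \<in> parcs (circulant_graph n (connection_set n D))"
proof -
  have sub: "D \<subseteq> {0..<int n}" using D(1) by (simp add: is_difference_set_def)
  have n: "int n > 0" using uv by auto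
  let ?g = "(v - u) mod int n"
  have "?g \<noteq> 0"
  proof
    assume "?g = 0"
    then have "v mod int n = u mod int n" by (simp add: mod_eq_dvd_iff mod_eq_0_iff_dvd)
    with uv show False by simp
  qed
  moreover have "?g \<in> {0..<int n}" using n by simp
  ultimately have "\<exists>p. p \<in> D \<times> D \<and> ?g = (fst p - snd p) mod int n"
    using D(1) unfolding is_difference_set_def by blast
  then obtain a b where ab: "a \<in> D" "b \<in> D" and g: "?g = (a - b) mod int n"
    by auto
  define w where "w = (v - a) mod int n"
  have w: "w \<in> {0..<int n}" using n by (simp add: w_def)
  have "(v - w) mod int n = a mod int n"
    unfolding w_def by (simp add: mod_diff_right_eq)
  then have va: "(v - w) mod int n = a" using ab sub by auto
  have "(u - w) mod int n = (a - (v - u)) mod int n"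
    unfolding w_def by (simp add: mod_diff_right_eq algebra_simps)
  also have "\<dots> = (a - (a - b)) mod int n" using g by (metis mod_diff_right_eq)
  also have "\<dots> = b" using ab sub by auto
  finally have "(u - w) mod int n = b" .
  with va w ab uv show ?thesis
    using circulant_arcI[OF sub D(2)] by blast
qed

theorem theorem15:
  fixes q n :: nat and D :: "int set"
  assumes "primepow q"
    and "n = q ^ 2 + q + 1"
    and "is_difference_set n D"
    and "0 \<notin> D"
    and "card D = q + 1"
  shows "harmonious_chromatic_number (circulant_graph n (connection_set n D)) = n"
proof -
  let ?G = "circulant_graph n (connection_set n D)"
  have "q > 0" using assms(1) by (rule primepow_gt_0_nat)
  then have "q ^ 2 > 0" by simp
  with \<open>q > 0\<close> have "n \<ge> 3" using assms(2) by linarith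
  moreover have "D \<subseteq> {0..<int n}" using assms(3) by (simp add: is_difference_set_def)
  ultimately interpret pair_graph ?G
    using assms(4) by (intro pair_graph_circulant_graph connection_set_subset)
  have verts: "pverts ?G = {0..<int n}" by (simp add: circulant_graph_def)
  have "harmonious_chromatic_number ?G = card (pverts ?G)"
    using difference_set_common_neighbor[OF assms(3,4)] verts
    by (intro harmonious_chromatic_number_eq_card) auto
  with verts show ?thesis by simp
qed

end
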